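(* If $G$ is a connected graph on at most $8$ vertices, then $c_L(G)\leq 2$.
   Context: All graphs are finite, simple and undirected. Lazy cops and robbers with $k$ cops on a graph $G$: first each cop chooses a starting vertex; then, seeing this, the robber chooses a starting vertex. The two sides then alternate turns, with perfect information, the cops going first. On the cops' turn, at most one cop (chosen by the cops) may move along an edge of $G$ to an adjacent vertex, and all other cops stay put. On the robber's turn, he may move along an edge or stay put. The cops win if at any point a cop occupies the same vertex as the robber; the robber wins if he evades the cops indefinitely. The lazy cop number $c_L(G)$ is the minimum $k$ for which $k$ cops have a strategy guaranteeing that they catch the robber after finitely many moves. *)

theory Defs
  imports "Graph_Theory.Digraph_Component"
begin

text \<open>
  Finite simple undirected graphs are those satisfying the locale predicate \<^const>\<open>Digraph.graph\<close>
  (finite, loop-free, symmetric, no parallel arcs). The graphs that are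
  \<^const>\<open>Digraph_Component.connected\<close> have a nonempty vertex set.

  A cop position is the list of the vertices occupied by the cops; several cops may share a vertex.
\<close>

definition lazy_move :: "('a, 'b) pre_digraph \<Rightarrow> 'a list \<Rightarrow> 'a list \<Rightarrow> bool" where
  "lazy_move G C C' \<longleftrightarrow>
     C' = C \<or> (\<exists>i < length C. \<exists>v. C ! i \<rightarrow>\<^bsub>G\<^esub> v \<and> C' = C[i := v])"

definition robber_walk :: "('a, 'b) pre_digraph \<Rightarrow> (nat \<Rightarrow> 'a) \<Rightarrow> bool" where
  "robber_walk G R \<longleftrightarrow>
     R 0 \<in> verts G \<and> (\<forall>n. R (Suc n) = R n \<or> R n \<rightarrow>\<^bsub>G\<^esub> R (Suc n))"

text \<open>
  A cop strategy \<open>S\<close> maps the list of the robber's positions so far, oldest first, to the resulting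
  cop position. The earlier cop positions are determined by \<open>S\<close> and this list, so this covers all
  (history-dependent) strategies with perfect information. Thus \<open>S []\<close> is the initial
  placement of the cops, which the robber sees before he chooses \<open>R 0\<close>.
\<close>

definition cop_pos :: "('a list \<Rightarrow> 'a list) \<Rightarrow> (nat \<Rightarrow> 'a) \<Rightarrow> nat \<Rightarrow> 'a list" where
  "cop_pos S R n = S (map R [0..<n])"

definition cop_strategy ::
  "('a, 'b) pre_digraph \<Rightarrow> nat \<Rightarrow> ('a list \<Rightarrow> 'a list) \<Rightarrow> bool" where
  "cop_strategy G k S \<longleftrightarrow>
     length (S []) = k \<and> set (S []) \<subseteq> verts G \<and>
     (\<forall>R. robber_walk G R \<longrightarrow> (\<forall>n. lazy_move G (cop_pos S R n) (cop_pos S R (Suc n))))"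

text \<open>
  In each round \<open>n\<close> the cops move from \<open>cop_pos S R n\<close> to \<open>cop_pos S R (Suc n)\<close>, and then the robber
  moves from \<open>R n\<close> to \<open>R (Suc n)\<close>. Hence the robber at \<open>R n\<close> meets the cops first at \<open>cop_pos S R n\<close>
  (right after his own move) and then at \<open>cop_pos S R (Suc n)\<close> (right after theirs). As
  passing is allowed on both sides, letting the play run on after a capture restricts nobody.
\<close>

definition captured :: "('a list \<Rightarrow> 'a list) \<Rightarrow> (nat \<Rightarrow> 'a) \<Rightarrow> bool" where
  "captured S R \<longleftrightarrow> (\<exists>n. R n \<in> set (cop_pos S R n) \<or> R n \<in> set (cop_pos S R (Suc n)))"

definition lazy_cops_win :: "('a, 'b) pre_digraph \<Rightarrow> nat \<Rightarrow> bool" where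
  "lazy_cops_win G k \<longleftrightarrow>
     (\<exists>S. cop_strategy G k S \<and> (\<forall>R. robber_walk G R \<longrightarrow> captured S R))"

definition lazy_cop_number :: "('a, 'b) pre_digraph \<Rightarrow> nat" where
  "lazy_cop_number G = (LEAST k. lazy_cops_win G k)"

text \<open>The minimum above is taken over a nonempty set, since a cop on every vertex wins at once.\<close>

lemma lazy_cops_win_card_verts:
  assumes "finite (verts G)"
  shows "lazy_cops_win G (card (verts G))"
proof -
  obtain vs where vs: "set vs = verts G" "distinct vs"
    using finite_distinct_list[OF assms] by blast
  have "cop_strategy G (card (verts G)) (\<lambda>_. vs)"
    using vs distinct_card[OF vs(2)] by (simp add: cop_strategy_def lazy_move_def cop_pos_def)
  moreover have "captured (\<lambda>_. vs) R" if "robber_walk G R" for R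
    using that vs(1) by (auto simp: captured_def cop_pos_def robber_walk_def)
  ultimately show ?thesis
    unfolding lazy_cops_win_def by blast
qed

lemma lazy_cops_win_lazy_cop_number:
  "finite (verts G) \<Longrightarrow> lazy_cops_win G (lazy_cop_number G)"
  unfolding lazy_cop_number_def by (rule LeastI) (rule lazy_cops_win_card_verts)

end

theory Submission
  imports Defs
begin

text \<open>
  One cop stays on a vertex \<open>v\<close> for the whole game. A robber who enters a neighbour of \<open>v\<close> is caught
  at once, so he is confined to the set \<open>H\<close> of the vertices outside the closed neighbourhood of \<open>v\<close>,
  and the other cop may use every turn to hunt him there (\<open>territory\<close>).

  If all degrees are at most \<open>2\<close>, the second cop enters \<open>H\<close> from a neighbour of \<open>v\<close>; from then on
  each vertex he visits has at most one neighbour that the robber can still use, so he sweeps \<open>H\<close>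
  vertex by vertex (\<open>sweep\<close>).

  If \<open>v\<close> has degree at least \<open>3\<close>, then \<open>H\<close> has at most \<open>4\<close> vertices. Among the connected graphs on
  at most \<open>4\<close> vertices, only the \<open>4\<close>-cycle lets a robber escape a single hunter forever
  (\<open>undefeated_robber_square\<close>). So if two cops never win, then every vertex of degree at least \<open>3\<close>
  has degree exactly \<open>3\<close> and its non-neighbours form a \<open>4\<close>-cycle. In such a \<open>4\<close>-cycle, some \<open>h\<close> has
  a third neighbour, because the graph is connected. The vertex \<open>y\<close> opposite to \<open>h\<close> then lies in the
  \<open>4\<close>-cycle of the non-neighbours of \<open>h\<close>, which gives it two neighbours besides the two that it
  shares with \<open>h\<close>: degree \<open>4\<close>, a contradiction.
\<close>

\<comment> \<open>The arrow \<open>\<rightarrow>\<close> stands for arcs only.\<close>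
unbundle no funcset_syntax

section \<open>Winning positions and strategies\<close>

definition closed_nbhd :: "('a, 'b) pre_digraph \<Rightarrow> 'a \<Rightarrow> 'a set" where
  "closed_nbhd G x = insert x {y. x \<rightarrow>\<^bsub>G\<^esub> y}"

text \<open>
  The positions with the cops to move from which the cops can force a capture. A robber who has just
  stepped onto a cop needs no rule of his own: the cops pass and \<open>catch\<close> applies.
\<close>

inductive winning :: "('a, 'b) pre_digraph \<Rightarrow> 'a list \<Rightarrow> 'a \<Rightarrow> bool" for G where
  catch: "lazy_move G C C' \<Longrightarrow> r \<in> set C' \<Longrightarrow> winning G C r"
| chase: "lazy_move G C C' \<Longrightarrow> (\<And>r'. r' \<in> closed_nbhd G r \<Longrightarrow> winning G C' r') \<Longrightarrow> winning G C r"

lemma lazy_move_refl: "lazy_move G C C"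
  by (simp add: lazy_move_def)

lemma cop_pos_0: "cop_pos S R 0 = S []"
  by (simp add: cop_pos_def)

lemma cop_pos_Suc: "cop_pos S R (Suc n) = S (R 0 # map (R \<circ> Suc) [0..<n])"
  by (simp add: cop_pos_def map_upt_Suc comp_def del: upt_Suc)

lemma (in wf_digraph) robber_walk_tail:
  assumes "robber_walk G R"
  shows "robber_walk G (R \<circ> Suc)"
  using assms unfolding robber_walk_def by (metis adj_in_verts(2) comp_apply)

text \<open>
  Induction on the winning position. After the cops' move, every reply \<open>r'\<close> of the robber leads to a
  winning position with a strategy \<open>T r'\<close> of its own; since a strategy sees the whole history, these
  can be glued together by reading off the robber's reply.
\<close>

lemma (in wf_digraph) winning_imp_strategy:
  assumes "winning G C r"
  shows "\<exists>S. S [] = C \<and> (\<forall>R. robber_walk G R \<and> R 0 = r \<longrightarrow>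
           (\<forall>n. lazy_move G (cop_pos S R n) (cop_pos S R (Suc n))) \<and> captured S R)"
  using assms
proof induction
  case (catch C C' r)
  define S where "S rs = (if rs = [] then C else C')" for rs :: "'a list"
  have pos: "cop_pos S R 0 = C" "cop_pos S R (Suc n) = C'" for R n
    by (simp_all add: cop_pos_0 cop_pos_Suc S_def)
  have "lazy_move G (cop_pos S R n) (cop_pos S R (Suc n))" for R n
    using catch(1) by (cases n) (simp_all add: pos lazy_move_refl)
  moreover have "captured S R" if "R 0 = r" for R
    unfolding captured_def using that catch(2) pos(2) by metis
  moreover have "S [] = C"
    by (simp add: S_def)
  ultimately show ?case by blast
next
  case (chase C C' r)
  then obtain T where T: "\<And>r'. r' \<in> closed_nbhd G r \<Longrightarrow> T r' [] = C' \<and>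
      (\<forall>R. robber_walk G R \<and> R 0 = r' \<longrightarrow>
        (\<forall>n. lazy_move G (cop_pos (T r') R n) (cop_pos (T r') R (Suc n))) \<and> captured (T r') R)"
    by metis
  define S where "S rs = (case rs of [] \<Rightarrow> C | _ # rs' \<Rightarrow>
      (case rs' of [] \<Rightarrow> C' | r' # _ \<Rightarrow> T r' rs'))" for rs
  have "(\<forall>n. lazy_move G (cop_pos S R n) (cop_pos S R (Suc n))) \<and> captured S R"
    if R: "robber_walk G R" "R 0 = r" for R
  proof -
    have nb: "R 1 \<in> closed_nbhd G r"
      using R unfolding robber_walk_def closed_nbhd_def
      by (metis One_nat_def insert_iff mem_Collect_eq)
    let ?R = "R \<circ> Suc"
    have R': "robber_walk G ?R" "?R 0 = R 1"
      using robber_walk_tail[OF R(1)] by simp_all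
    have pos: "cop_pos S R (Suc n) = cop_pos (T (R 1)) ?R n" for n
      using T[OF nb] by (cases n) (simp_all add: cop_pos_Suc cop_pos_0 S_def map_upt_Suc comp_def del: upt_Suc)
    have legal: "lazy_move G (cop_pos (T (R 1)) ?R n) (cop_pos (T (R 1)) ?R (Suc n))" for n
      using T[OF nb] R' by blast
    have "lazy_move G (cop_pos S R n) (cop_pos S R (Suc n))" for n
    proof (cases n)
      case 0
      then show ?thesis
        using chase(1) T[OF nb] by (simp add: pos) (simp add: cop_pos_0 S_def)
    next
      case (Suc m)
      then show ?thesis using legal by (simp add: pos)
    qed
    moreover have "captured (T (R 1)) ?R"
      using T[OF nb] R' by blast
    then have "captured S R"
      unfolding captured_def by (metis comp_apply pos)
    ultimately show ?thesis by blast
  qed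
  moreover have "S [] = C"
    by (simp add: S_def)
  ultimately show ?case by blast
qed

lemma (in wf_digraph) winning_imp_lazy_cops_win:
  assumes "set C \<subseteq> verts G" and "\<And>r. r \<in> verts G \<Longrightarrow> winning G C r"
  shows "lazy_cops_win G (length C)"
proof -
  from winning_imp_strategy[OF assms(2)]
  obtain T where T: "\<And>r. r \<in> verts G \<Longrightarrow> T r [] = C \<and>
      (\<forall>R. robber_walk G R \<and> R 0 = r \<longrightarrow>
        (\<forall>n. lazy_move G (cop_pos (T r) R n) (cop_pos (T r) R (Suc n))) \<and> captured (T r) R)"
    by metis
  define S where "S rs = (case rs of [] \<Rightarrow> C | r # _ \<Rightarrow> T r rs)" for rs
  have "(\<forall>n. lazy_move G (cop_pos S R n) (cop_pos S R (Suc n))) \<and> captured S R"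
    if R: "robber_walk G R" for R
  proof -
    have v: "R 0 \<in> verts G"
      using R by (simp add: robber_walk_def)
    have "cop_pos S R n = cop_pos (T (R 0)) R n" for n
      using T[OF v] by (cases n) (simp_all add: cop_pos_Suc cop_pos_0 S_def)
    then show ?thesis
      using T[OF v] R by (simp add: captured_def)
  qed
  moreover have "S [] = C"
    by (simp add: S_def)
  ultimately show ?thesis
    unfolding lazy_cops_win_def cop_strategy_def using assms(1) by blast
qed

section \<open>A guard and a hunter\<close>

locale connected_graph = graph +
  assumes reachable: "x \<in> verts G \<Longrightarrow> y \<in> verts G \<Longrightarrow> x \<rightarrow>\<^sup>* y"
begin

lemma adj_sym: "x \<rightarrow> y \<Longrightarrow> y \<rightarrow> x"
  by (rule arcs_ends_symmetric[OF sym_arcs])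

lemma adj_irrefl: "\<not> x \<rightarrow> x"
  using adj_not_same[of x] by auto

lemma finite_nbhd: "finite {y. x \<rightarrow> y}"
  by (rule finite_subset[OF _ finite_verts]) (auto dest: adj_in_verts)

lemma closed_nbhd_in_verts: "x \<in> verts G \<Longrightarrow> closed_nbhd G x \<subseteq> verts G"
  by (auto simp: closed_nbhd_def dest: adj_in_verts)

lemma edge_leaving:
  assumes "A \<subseteq> verts G" "A \<noteq> {}" "A \<noteq> verts G"
  obtains a b where "a \<in> A" "b \<in> verts G - A" "a \<rightarrow> b"
proof -
  obtain x y where xy: "x \<in> A" "y \<in> verts G - A" using assms by blast
  then have "x \<rightarrow>\<^sup>* y" using assms(1) by (blast intro: reachable)
  then have "\<exists>a\<in>A. \<exists>b\<in>verts G - A. a \<rightarrow> b" using xy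
  proof (induction rule: converse_reachable_induct)
    case (step x z)
    then show ?case by (metis Diff_iff adj_in_verts(2))
  qed simp
  then show ?thesis using that by blast
qed

lemma capture_adjacent:
  assumes "r \<in> closed_nbhd G v \<or> r \<in> closed_nbhd G u"
  shows "winning G [v, u] r"
proof -
  have "lazy_move G [v, u] [r, u]" if "v \<rightarrow> r"
    unfolding lazy_move_def using that by (intro disjI2 exI[of _ 0]) auto
  moreover have "lazy_move G [v, u] [v, r]" if "u \<rightarrow> r"
    unfolding lazy_move_def using that by (intro disjI2 exI[of _ 1]) auto
  ultimately show ?thesis
    using assms catch[OF lazy_move_refl, of r "[v, u]" G] catch[of G "[v, u]" "[r, u]" r]
      catch[of G "[v, u]" "[v, r]" r]
    by (auto simp: closed_nbhd_def)
qed

lemma hunter_moves: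
  assumes "w \<in> closed_nbhd G u" and "\<And>r'. r' \<in> closed_nbhd G r \<Longrightarrow> winning G [v, w] r'"
  shows "winning G [v, u] r"
proof -
  have "lazy_move G [v, u] [v, w]"
  proof (cases "w = u")
    case False
    then show ?thesis
      unfolding lazy_move_def using assms(1)
      by (intro disjI2 exI[of _ 1]) (auto simp: closed_nbhd_def)
  qed (simp add: lazy_move_refl)
  then show ?thesis using assms(2) by (rule chase)
qed

text \<open>With a cop on \<open>v\<close>, a robber in \<open>K\<close> can only leave \<open>K\<close> by letting that cop catch him.\<close>

definition territory :: "'a \<Rightarrow> 'a set \<Rightarrow> bool" where
  "territory v K \<longleftrightarrow> K \<subseteq> verts G - closed_nbhd G v \<and> (\<forall>x\<in>K. closed_nbhd G x \<subseteq> K \<union> closed_nbhd G v)"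

lemma territory_outside: "territory v (verts G - closed_nbhd G v)"
  unfolding territory_def using closed_nbhd_in_verts by blast

text \<open>
  While the guard confines the robber, the hunter can walk to any vertex \<open>q\<close> before the hunt begins;
  whatever the robber does meanwhile, he is still in \<open>K\<close> or caught.
\<close>

lemma hunter_relocates:
  assumes "territory v K" and "\<And>r. r \<in> K \<Longrightarrow> winning G [v, q] r"
    and "u \<in> verts G" "q \<in> verts G" and "r \<in> K"
  shows "winning G [v, u] r"
  using reachable[OF assms(3,4)] assms(5)
proof (induction arbitrary: r rule: converse_reachable_induct)
  case base
  then show ?case using assms(2) by blast
next
  case (step u w)
  show ?case
  proof (rule hunter_moves)
    show "w \<in> closed_nbhd G u"
      using step by (simp add: closed_nbhd_def)
    show "winning G [v, w] r'" if "r' \<in> closed_nbhd G r" for r'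
    proof (cases "r' \<in> K")
      case True
      then show ?thesis by (rule step.IH)
    next
      case False
      then show ?thesis
        using that assms(1) step.prems capture_adjacent unfolding territory_def by blast
    qed
  qed
qed

section \<open>Graphs of maximum degree two\<close>

text \<open>
  The hunter on \<open>u\<close> has just cleaned up everything behind him, and has at most one neighbour \<open>w\<close>
  in the set \<open>K\<close> where the robber can be. Moving there shrinks \<open>K\<close>, and he again has at most one
  neighbour ahead, since one of his two neighbours is \<open>u\<close>. If he has none, then \<open>v\<close> alone confines
  the robber to \<open>K\<close>, and the hunter has all the time to walk to a neighbour of \<open>v\<close> next to \<open>K\<close>; there
  one of his two neighbours is \<open>v\<close>.
\<close>

lemma sweep:
  assumes deg: "\<And>x. card {y. x \<rightarrow> y} \<le> 2"
    and v: "v \<in> verts G" and u: "u \<in> verts G"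
    and K: "K \<subseteq> verts G - closed_nbhd G v" "u \<notin> K"
    and confined: "\<And>x. x \<in> K \<Longrightarrow> closed_nbhd G x \<subseteq> insert u K \<union> closed_nbhd G v"
    and single: "\<And>x y. x \<in> K \<Longrightarrow> y \<in> K \<Longrightarrow> u \<rightarrow> x \<Longrightarrow> u \<rightarrow> y \<Longrightarrow> x = y"
    and r: "r \<in> K"
  shows "winning G [v, u] r"
proof -
  have two: "y = z" if "x \<rightarrow> p" "x \<rightarrow> y" "x \<rightarrow> z" "p \<noteq> y" "p \<noteq> z" for x p y z
  proof (rule ccontr)
    assume "y \<noteq> z"
    then have "3 = card {p, y, z}" using that by simp
    also have "\<dots> \<le> card {y. x \<rightarrow> y}"
      by (rule card_mono[OF finite_nbhd]) (use that in auto)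
    finally show False using deg[of x] by simp
  qed
  have "finite K" by (rule finite_subset[OF _ finite_verts]) (use K(1) in blast)
  then show ?thesis using u K confined single r
  proof (induction K arbitrary: u r rule: finite_psubset_induct)
    case (psubset K)
    have advance: "winning G [v, u] r"
      if u: "u \<in> verts G" "u \<notin> K" and "u \<rightarrow> w" and "w \<in> K" and "r \<in> K"
        and confined: "\<And>x. x \<in> K \<Longrightarrow> closed_nbhd G x \<subseteq> insert u K \<union> closed_nbhd G v"
        and single: "\<And>x. x \<in> K \<Longrightarrow> u \<rightarrow> x \<Longrightarrow> x = w" for u w r
    proof (cases "r = w")
      case True
      then show ?thesis
        using \<open>u \<rightarrow> w\<close> by (intro capture_adjacent) (simp add: closed_nbhd_def)
    next
      case False
      show ?thesis
      proof (rule hunter_moves)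
        show "w \<in> closed_nbhd G u" using \<open>u \<rightarrow> w\<close> by (simp add: closed_nbhd_def)
        have ahead: "closed_nbhd G x \<subseteq> insert w (K - {w}) \<union> closed_nbhd G v" if "x \<in> K - {w}" for x
        proof -
          have "u \<notin> closed_nbhd G x"
            using that u(2) single[of x] adj_sym[of x u] by (auto simp: closed_nbhd_def)
          then show ?thesis using confined[of x] that by blast
        qed
        show "winning G [v, w] r'" if r': "r' \<in> closed_nbhd G r" for r'
        proof (cases "r' \<in> K - {w}")
          case True
          show ?thesis
          proof (rule psubset.IH)
            show "K - {w} \<subset> K" using \<open>w \<in> K\<close> by blast
            show "w \<in> verts G" "K - {w} \<subseteq> verts G - closed_nbhd G v"
              using psubset.prems(2) \<open>w \<in> K\<close> by blast+
            show "x = y" if "x \<in> K - {w}" "y \<in> K - {w}" "w \<rightarrow> x" "w \<rightarrow> y" for x y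
              using two[of w u x y] that u adj_sym[OF \<open>u \<rightarrow> w\<close>] by blast
          qed (use ahead True in auto)
        next
          case False
          then have "r' = w \<or> r' \<in> closed_nbhd G v"
            using ahead[of r] r' \<open>r \<noteq> w\<close> \<open>r \<in> K\<close> by blast
          then show ?thesis by (intro capture_adjacent) (auto simp: closed_nbhd_def)
        qed
      qed
    qed
    show ?case
    proof (cases "\<exists>w\<in>K. u \<rightarrow> w")
      case True
      then obtain w where w: "w \<in> K" "u \<rightarrow> w" by blast
      show ?thesis
        by (rule advance[OF psubset.prems(1,3) w(2,1) psubset.prems(6) psubset.prems(4)])
          (use psubset.prems(5) w in auto)
    next
      case False
      have terr: "territory v K"
        unfolding territory_def
      proof (intro conjI ballI)
        fix x assume x: "x \<in> K"
        have "u \<notin> closed_nbhd G x"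
          using x False psubset.prems(3) adj_sym by (auto simp: closed_nbhd_def)
        then show "closed_nbhd G x \<subseteq> K \<union> closed_nbhd G v"
          using psubset.prems(4)[OF x] by blast
      qed (rule psubset.prems(2))
      have vK: "v \<notin> K" using psubset.prems(2) by (auto simp: closed_nbhd_def)
      obtain w p where w: "w \<in> K" and p: "p \<in> verts G - K" "w \<rightarrow> p"
        using edge_leaving[of K] psubset.prems(2,6) v vK by blast
      have "p \<in> closed_nbhd G v"
        using terr w p unfolding territory_def closed_nbhd_def by blast
      moreover have "p \<noteq> v"
        using w p psubset.prems(2) adj_sym by (auto simp: closed_nbhd_def)
      ultimately have pv: "p \<rightarrow> v"
        using adj_sym by (simp add: closed_nbhd_def)
      have pw: "p \<rightarrow> w" using p(2) by (rule adj_sym)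
      have "winning G [v, p] r'" if r': "r' \<in> K" for r'
      proof (rule advance[of p w])
        show "closed_nbhd G x \<subseteq> insert p K \<union> closed_nbhd G v" if "x \<in> K" for x
          using terr that unfolding territory_def by blast
        show "x = w" if "x \<in> K" "p \<rightarrow> x" for x
          using two[OF pv that(2) pw] that(1) vK w by blast
      qed (use p pw w r' in auto)
      then show ?thesis
        using hunter_relocates[OF terr _ psubset.prems(1)] p(1) psubset.prems(6) by blast
    qed
  qed
qed

section \<open>Hunting among at most four vertices\<close>

text \<open>
  The robber moves in a connected piece \<open>K\<close> of the vertices outside the closed neighbourhood of \<open>v\<close>.
  If no vertex dominates \<open>K\<close>, a path \<open>q, t, s\<close> in \<open>K\<close> and a fourth vertex \<open>p\<close> not adjacent to \<open>t\<close>
  make up \<open>K\<close>. A hunter on \<open>t\<close> leaves the robber only \<open>p\<close>. If \<open>p\<close> is adjacent to only one of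
  \<open>q\<close> and \<open>s\<close>, the hunter steps there and the robber has nowhere to go. So \<open>p\<close> is adjacent to both.
\<close>

lemma undefeated_robber_square:
  assumes v: "v \<in> verts G" and r: "r \<in> verts G" and undefeated: "\<not> winning G [v, v] r"
    and small: "card (verts G - closed_nbhd G v) \<le> 4"
  obtains q t s p where "verts G - closed_nbhd G v = {q, t, s, p}" "distinct [q, t, s, p]"
    "q \<rightarrow> t" "t \<rightarrow> s" "s \<rightarrow> p" "p \<rightarrow> q"
proof -
  let ?H = "verts G - closed_nbhd G v"
  have rH: "r \<in> ?H" using r undefeated capture_adjacent by blast
  \<comment> \<open>The connected component of \<open>r\<close> in \<open>H\<close>, obtained as a smallest territory around \<open>r\<close>.\<close>
  obtain K where K: "territory v K" "r \<in> K"
    and least: "\<And>L. territory v L \<and> r \<in> L \<Longrightarrow> card K \<le> card L"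
    using ex_has_least_nat[of "\<lambda>K. territory v K \<and> r \<in> K" ?H card] territory_outside rH by blast
  have KH: "K \<subseteq> ?H" using K(1) by (simp add: territory_def)
  have finH: "finite ?H" by simp
  have finK: "finite K" using KH finH by (rule finite_subset)
  have conn: "\<exists>a\<in>A. \<exists>b\<in>K - A. a \<rightarrow> b" if A: "A \<subseteq> K" "A \<noteq> {}" "A \<noteq> K" for A
  proof (rule ccontr)
    assume split: "\<not> ?thesis"
    have "closed_nbhd G x \<subseteq> A \<union> closed_nbhd G v" if "x \<in> A" for x
    proof
      fix y assume y: "y \<in> closed_nbhd G x"
      then have "y \<in> K \<union> closed_nbhd G v" "y = x \<or> x \<rightarrow> y"
        using that A K(1) by (auto simp: territory_def closed_nbhd_def)
      then show "y \<in> A \<union> closed_nbhd G v" using split that by blast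
    qed
    then have "territory v A" using A KH by (auto simp: territory_def)
    have "closed_nbhd G x \<subseteq> (K - A) \<union> closed_nbhd G v" if "x \<in> K - A" for x
    proof
      fix y assume y: "y \<in> closed_nbhd G x"
      then have "y \<in> K \<union> closed_nbhd G v" "y = x \<or> y \<rightarrow> x"
        using that K(1) adj_sym by (auto simp: territory_def closed_nbhd_def)
      then show "y \<in> (K - A) \<union> closed_nbhd G v" using split that by blast
    qed
    then have "territory v (K - A)" using KH by (auto simp: territory_def)
    moreover have "card A < card K" "card (K - A) < card K"
      using A finK by (auto intro!: psubset_card_mono)
    ultimately show False
      using least[of A] least[of "K - A"] \<open>territory v A\<close> K(2) by auto
  qed
  have no_win: "\<exists>r'\<in>K. \<not> winning G [v, q] r'" if "q \<in> K" for q
    using that KH undefeated hunter_relocates[OF K(1) _ v _ K(2)] by blast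
  have not_dominated: "\<exists>p\<in>K. p \<notin> closed_nbhd G q" if "q \<in> K" for q
    using no_win[OF that] capture_adjacent by blast
  obtain t s where t: "t \<in> closed_nbhd G r \<inter> K" and s: "s \<in> K - closed_nbhd G r \<inter> K" and ts: "t \<rightarrow> s"
    using conn[of "closed_nbhd G r \<inter> K"] not_dominated[OF K(2)] K(2)
    by (auto simp: closed_nbhd_def)
  have rt: "r \<rightarrow> t" "r \<noteq> t" "r \<noteq> s" "t \<noteq> s"
    using t s ts adj_irrefl by (auto simp: closed_nbhd_def)
  obtain p where p: "p \<in> K" "p \<notin> closed_nbhd G t"
    using not_dominated t by blast
  have dist: "distinct [r, t, s, p]"
    using rt p ts adj_sym by (auto simp: closed_nbhd_def)
  have sub: "{r, t, s, p} \<subseteq> K" using K(2) t s p by blast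
  have c4: "card {r, t, s, p} = 4" using dist by simp
  have K4: "K = {r, t, s, p}" and H4: "?H = {r, t, s, p}"
    using card_seteq[OF finK sub] card_seteq[OF finH, of "{r, t, s, p}"] card_mono[OF finH KH]
      sub KH small c4 by auto
  have tp: "\<not> t \<rightarrow> p" "\<not> p \<rightarrow> t" using p adj_sym by (auto simp: closed_nbhd_def)
  obtain z where z: "z \<in> {r, s}" "p \<rightarrow> z"
    using conn[of "{p}"] sub K4 rt tp by auto
  have corner: "p \<rightarrow> z'" if zz: "{z, z'} = {r, s}" for z'
  proof (rule ccontr)
    assume nz': "\<not> p \<rightarrow> z'"
    have z': "z' \<in> {r, s}" "K = {z, z', t, p}" using zz K4 by auto
    have "winning G [v, t] r'" if r': "r' \<in> K" for r'
    proof (cases "r' = p")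
      case False
      then show ?thesis
        using r' K4 rt ts adj_sym by (intro capture_adjacent) (auto simp: closed_nbhd_def)
    next
      case True
      show ?thesis
      proof (rule hunter_moves)
        show "z \<in> closed_nbhd G t" using z rt ts adj_sym by (auto simp: closed_nbhd_def)
        fix y assume y: "y \<in> closed_nbhd G r'"
        then have "y \<in> K \<union> closed_nbhd G v"
          using K(1) r' unfolding territory_def by blast
        moreover have "y \<noteq> t" "y \<noteq> z'"
          using y True tp nz' p(2) z' dist by (auto simp: closed_nbhd_def)
        ultimately have "y = z \<or> y = p \<or> y \<in> closed_nbhd G v" using z'(2) by blast
        then show "winning G [v, z] y"
          using adj_sym[OF z(2)] by (intro capture_adjacent) (auto simp: closed_nbhd_def)
      qed
    qed
    then show False using no_win t by blast
  qed
  have "p \<rightarrow> r" "p \<rightarrow> s"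
    using z corner by (auto simp: insert_commute)
  then show ?thesis
    using that[OF H4 dist rt(1) ts] adj_sym by blast
qed

text \<open>The same fact, read off from an arbitrary vertex \<open>h\<close> of the \<open>4\<close>-cycle.\<close>

corollary undefeated_robber_square_at:
  assumes "v \<in> verts G" "r \<in> verts G" "\<not> winning G [v, v] r"
    and "card (verts G - closed_nbhd G v) \<le> 4"
    and "h \<in> verts G - closed_nbhd G v"
  obtains x y z where "verts G - closed_nbhd G v = {h, x, y, z}" "distinct [h, x, y, z]"
    "h \<rightarrow> x" "x \<rightarrow> y" "y \<rightarrow> z" "z \<rightarrow> h"
proof -
  obtain q t s p where H: "verts G - closed_nbhd G v = {q, t, s, p}" "distinct [q, t, s, p]"
    "q \<rightarrow> t" "t \<rightarrow> s" "s \<rightarrow> p" "p \<rightarrow> q"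
    using undefeated_robber_square[OF assms(1-4)] .
  consider "h = q" | "h = t" | "h = s" | "h = p"
    using assms(5) H(1) by blast
  then show ?thesis
  proof cases
    case 1 then show ?thesis using H by (intro that[of t s p]) auto
  next
    case 2 then show ?thesis using H by (intro that[of s p q]) auto
  next
    case 3 then show ?thesis using H by (intro that[of p q t]) auto
  next
    case 4 then show ?thesis using H by (intro that[of q t s]) auto
  qed
qed

section \<open>Connected graphs on at most eight vertices\<close>

lemma card_outside:
  assumes "x \<in> verts G"
  shows "card (verts G - closed_nbhd G x) + card {y. x \<rightarrow> y} + 1 = card (verts G)"
proof -
  have "card (closed_nbhd G x) = card {y. x \<rightarrow> y} + 1"
    unfolding closed_nbhd_def using finite_nbhd adj_irrefl by simp
  moreover have "card (verts G - closed_nbhd G x) + card (closed_nbhd G x) = card (verts G)"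
    using closed_nbhd_in_verts[OF assms] finite_verts card_mono[of "verts G" "closed_nbhd G x"]
    by (simp add: card_Diff_subset finite_subset)
  ultimately show ?thesis by simp
qed

lemma winning_start:
  assumes "verts G \<noteq> {}" and n8: "card (verts G) \<le> 8"
  shows "\<exists>v\<in>verts G. \<forall>r\<in>verts G. winning G [v, v] r"
proof (rule ccontr)
  assume "\<not> ?thesis"
  then have undefeated: "\<exists>r\<in>verts G. \<not> winning G [v, v] r" if "v \<in> verts G" for v
    using that by blast
  have "\<exists>v. card {y. v \<rightarrow> y} > 2"
  proof (rule ccontr)
    assume "\<not> ?thesis"
    then have deg: "\<And>x. card {y. x \<rightarrow> y} \<le> 2" by (simp add: not_less)
    obtain v where v: "v \<in> verts G" using assms(1) by blast
    have "winning G [v, v] r" if "r \<in> verts G" for r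
    proof (cases "r \<in> closed_nbhd G v")
      case False
      show ?thesis
      proof (rule sweep[OF deg v v, of "verts G - closed_nbhd G v"])
        show "closed_nbhd G x \<subseteq> insert v (verts G - closed_nbhd G v) \<union> closed_nbhd G v"
          if "x \<in> verts G - closed_nbhd G v" for x
          using that closed_nbhd_in_verts by blast
      qed (use that False in \<open>auto simp: closed_nbhd_def\<close>)
    qed (simp add: capture_adjacent)
    then show False using undefeated[OF v] by blast
  qed
  then obtain v where v3: "card {y. v \<rightarrow> y} > 2" by blast
  have big_in_verts: "x \<in> verts G" if "card {y. x \<rightarrow> y} > 2" for x
  proof -
    have "{y. x \<rightarrow> y} \<noteq> {}" using that by force
    then show ?thesis by (auto dest: adj_in_verts)
  qed
  have outside4: "card (verts G - closed_nbhd G x) \<le> 4" if "card {y. x \<rightarrow> y} > 2" for x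
    using card_outside[OF big_in_verts[OF that]] that n8 by simp
  have square: "\<exists>x y z. verts G - closed_nbhd G c = {h, x, y, z} \<and> distinct [h, x, y, z] \<and>
      h \<rightarrow> x \<and> x \<rightarrow> y \<and> y \<rightarrow> z \<and> z \<rightarrow> h"
    if c: "card {y. c \<rightarrow> y} > 2" and h: "h \<in> verts G - closed_nbhd G c" for c h
  proof -
    obtain r where "r \<in> verts G" "\<not> winning G [c, c] r"
      using undefeated big_in_verts[OF c] by blast
    then show ?thesis
      by (rule undefeated_robber_square_at[OF big_in_verts[OF c] _ _ outside4[OF c] h]) blast
  qed
  \<comment> \<open>Four vertices outside the closed neighbourhood leave room for three neighbours.\<close>
  have deg3: "card {y. x \<rightarrow> y} \<le> 3" for x
  proof (cases "card {y. x \<rightarrow> y} > 2")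
    case True
    obtain r where r: "r \<in> verts G" "\<not> winning G [x, x] r"
      using undefeated big_in_verts[OF True] by blast
    have "card (verts G - closed_nbhd G x) = 4"
      by (rule undefeated_robber_square[OF big_in_verts[OF True] r outside4[OF True]]) simp
    then show ?thesis using card_outside[OF big_in_verts[OF True]] n8 by simp
  qed simp
  have no_four: False if "distinct [a, b, c, d]" "x \<rightarrow> a" "x \<rightarrow> b" "x \<rightarrow> c" "x \<rightarrow> d" for x a b c d
  proof -
    have "4 = card {a, b, c, d}" using that by simp
    also have "\<dots> \<le> card {y. x \<rightarrow> y}"
      by (rule card_mono[OF finite_nbhd]) (use that in auto)
    finally show False using deg3[of x] by simp
  qed
  let ?H = "verts G - closed_nbhd G v"
  have vv: "v \<in> verts G" using v3 by (rule big_in_verts)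
  have "?H \<noteq> {}"
  proof
    assume "?H = {}"
    then have "verts G \<subseteq> closed_nbhd G v" by auto
    then have "winning G [v, v] r" if "r \<in> verts G" for r
      using that capture_adjacent by blast
    then show False using undefeated[OF vv] by blast
  qed
  moreover have "?H \<noteq> verts G" using vv by (auto simp: closed_nbhd_def)
  ultimately obtain h a where h: "h \<in> ?H" and a: "a \<in> verts G - ?H" "h \<rightarrow> a"
    using edge_leaving[of ?H] by blast
  obtain x y z where H: "?H = {h, x, y, z}" and dist: "distinct [h, x, y, z]"
    and cyc: "h \<rightarrow> x" "x \<rightarrow> y" "y \<rightarrow> z" "z \<rightarrow> h"
    using square[OF v3 h] by blast
  have a_new: "distinct [x, z, a]" "a \<noteq> y" using a(1) H dist by auto
  have hz: "h \<rightarrow> z" and yx: "y \<rightarrow> x" using cyc adj_sym by blast+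
  have "card {x, z, a} \<le> card {y. h \<rightarrow> y}"
    by (rule card_mono[OF finite_nbhd]) (use cyc hz a in auto)
  then have h3: "card {y. h \<rightarrow> y} > 2" using a_new by simp
  have "\<not> h \<rightarrow> y"
    using no_four[of x z a y h] a_new dist cyc(1) hz a(2) by auto
  then have "y \<in> verts G - closed_nbhd G h"
    using H dist by (auto simp: closed_nbhd_def)
  then obtain k l m where H': "verts G - closed_nbhd G h = {y, k, l, m}" "distinct [y, k, l, m]"
    "y \<rightarrow> k" "m \<rightarrow> y"
    using square[OF h3] by blast
  have "x \<in> closed_nbhd G h" "z \<in> closed_nbhd G h"
    using cyc hz by (simp_all add: closed_nbhd_def)
  then have "distinct [x, z, k, m]" using H' dist by auto
  then show False
    using no_four[of x z k m y] yx cyc(3) H'(3) adj_sym[OF H'(4)] by blast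
qed

end

theorem theorem3p1:
  fixes G :: "('a, 'b) pre_digraph"
  assumes "Digraph.graph G"
    and "Digraph_Component.connected G"
    and "card (verts G) \<le> 8"
  shows "lazy_cop_number G \<le> 2"
proof -
  interpret graph G by (rule assms(1))
  have sc: "strongly_connected G"
    using sym_arcs assms(2) by (rule symmetric_connected_imp_strongly_connected)
  interpret connected_graph G
    by unfold_locales (use sc in blast)
  have "verts G \<noteq> {}" using sc by (simp add: strongly_connected_def)
  then obtain v where "v \<in> verts G" "\<And>r. r \<in> verts G \<Longrightarrow> winning G [v, v] r"
    using winning_start[OF _ assms(3)] by blast
  then have "lazy_cops_win G (length [v, v])"
    by (intro winning_imp_lazy_cops_win) auto
  then show ?thesis
    unfolding lazy_cop_number_def by (intro Least_le) (simp add: numeral_2_eq_2)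
qed

end
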